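(* Let $g:\mathbb{R}\to\mathbb{R}$ be bounded and increasing and let $V_0\in\mathbb{R}$. Consider the problem of maximizing the net profit $$\int_{-\infty}^\infty g(y)\,d\mathcal{E}(R)(y)-\int_0^1R(r)\,dr$$ over all $R\in\mathcal{R}_b^r$ with $\mathcal{V}(R)\ge V_0$. The optimal net profit is given by $$\frac{\int_{-\infty}^\infty\exp\left(\frac{g(y)}{2c\sigma^2}\right)f_0(y)g(y)\,dy}{\int_{-\infty}^\infty\exp\left(\frac{g(y)}{2c\sigma^2}\right)f_0(y)\,dy},$$ and is uniquely attained by $$R^*(r)=V_0+g(q_{\mu^*}(r))-2c\sigma^2\ln\left(\int_{-\infty}^\infty\exp\left(\frac{g(z)}{2c\sigma^2}\right)f_0(z)\,dz\right),$$ where $\mu^*$ is the probability measure on $\mathbb{R}$ with density $$f_{\mu^*}(y)=\frac{\exp\left(\frac{g(y)}{2c\sigma^2}\right)f_0(y)}{\int_{-\infty}^\infty\exp\left(\frac{g(z)}{2c\sigma^2}\right)f_0(z)\,dz}$$ and $q_{\mu^*}$ is its quantile function.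
   Context: Fix constants $T,\sigma,c>0$ and $x_0\in\mathbb{R}$. Let $f_0$ be the density of $\mathcal{N}(x_0,\sigma^2T)$. "Increasing" is understood in the weak sense. $\mathcal{R}_b^r$ is the set of bounded increasing functions $R:[0,1]\to\mathbb{R}$ (bounded purely rank-based rewards). Here $g(y)$ is the profit that a terminal output $y$ generates for the principal, and $V_0$ is the players' reservation utility. Game: let $\Omega=C([0,T],\mathbb{R})$ with canonical process $X$, and let $P$ be the law on $\Omega$ of $(x_0+\sigma B_t)_{t\in[0,T]}$, $B$ a standard Brownian motion started at $0$. Let $\mathcal{Q}=\{Q\in\mathcal{P}(\Omega):Q\sim P\}$ (probability measures mutually absolutely continuous with $P$), and write $Q_T$ for the law of $X_T$ under $Q$. With $H(Q|P)=E^Q[\ln(dQ/dP)]$ the relative entropy and $F_{\tilde\mu}$ the c.d.f. of a probability measure $\tilde\mu$ on $\mathbb{R}$, put $$V(R,\tilde\mu):=\sup_{Q\in\mathcal{Q}}\left\{E^Q\left[R(F_{\tilde\mu}(X_T))\right]-2c\sigma^2H(Q|P)\right\}.$$ A probability measure $\mu$ on $\mathbb{R}$ is an equilibrium for $R$ if it is a fixed point of the best response mapping $\tilde\mu\mapsto Q_T$, where $Q\in\mathcal{Q}$ is optimal for $V(R,\tilde\mu)$. Each $R\in\mathcal{R}_b^r$ has exactly one equilibrium, denoted $\mathcal{E}(R)$, and the game value is $\mathcal{V}(R):=V(R,\mathcal{E}(R))$.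
   Formalization: The displayed fraction is not the net profit (g=0 gives 0, true value −V_0): it is proved to be the gross profit ∫g dE(R* ), and the optimal net profit is 2cσ² ln(∫exp(g/(2cσ²))f_0) − V_0. R* is unique up to null sets of [0,1], as its endpoint values can be changed. *)

theory Defs
  imports "HOL-Probability.Probability"
begin

section \<open>Brownian motion and path space\<close>

definition standard_brownian_motion ::
    "'a measure \<Rightarrow> real \<Rightarrow> (real \<Rightarrow> 'a \<Rightarrow> real) \<Rightarrow> bool" where
  "standard_brownian_motion M T B \<longleftrightarrow>
     prob_space M \<and>
     (\<forall>t\<in>{0..T}. B t \<in> borel_measurable M) \<and>
     (\<forall>\<omega>\<in>space M. B 0 \<omega> = 0) \<and>
     (\<forall>\<omega>\<in>space M. continuous_on {0..T} (\<lambda>t. B t \<omega>)) \<and>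
     (\<forall>s t. 0 \<le> s \<and> s < t \<and> t \<le> T \<longrightarrow>
        distributed M lborel (\<lambda>\<omega>. B t \<omega> - B s \<omega>) (normal_density 0 (sqrt (t - s)))) \<and>
     (\<forall>n (t :: nat \<Rightarrow> real). 0 \<le> t 0 \<and> (\<forall>i<n. t i \<le> t (Suc i)) \<and> t n \<le> T \<longrightarrow>
        prob_space.indep_vars M (\<lambda>_. borel) (\<lambda>i \<omega>. B (t (Suc i)) \<omega> - B (t i) \<omega>) {..<n})"

text \<open>The space \<open>C([0,T], \<real>)\<close>: a path is an extensional function on \<open>{0..T}\<close> (undefined outside).
  The \<open>\<sigma>\<close>-algebra is the one generated by the canonical process \<open>X\<^sub>t(w) = w t\<close>; it is also
  the Borel \<open>\<sigma>\<close>-algebra of the uniform topology.\<close>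

definition path_space :: "real \<Rightarrow> (real \<Rightarrow> real) measure" where
  "path_space T = restrict_space (Pi\<^sub>M {0..T} (\<lambda>_. borel)) {w. continuous_on {0..T} w}"

definition path_law ::
    "'a measure \<Rightarrow> real \<Rightarrow> (real \<Rightarrow> 'a \<Rightarrow> real) \<Rightarrow> real \<Rightarrow> real \<Rightarrow> (real \<Rightarrow> real) measure" where
  "path_law M T B x0 \<sigma> = distr M (path_space T) (\<lambda>\<omega>. \<lambda>t\<in>{0..T}. x0 + \<sigma> * B t \<omega>)"

section \<open>The game\<close>

definition equivalent_probs :: "'w measure \<Rightarrow> 'w measure set" where
  "equivalent_probs P =
     {Q. prob_space Q \<and> sets Q = sets P \<and> absolutely_continuous P Q \<and> absolutely_continuous Q P}"

text \<open>\<open>H(Q|P) = E\<^sup>Q[ln (dQ/dP)]\<close> as an extended real. For probability measures \<open>Q \<lless> P\<close> the negative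
  part of \<open>ln (dQ/dP)\<close> is always \<open>Q\<close>-integrable, so non-integrability means that the expectation
  is \<open>\<infinity>\<close>; the Bochner integral inside \<^const>\<open>KL_divergence\<close> would return 0 instead.\<close>

definition rel_entropy :: "'w measure \<Rightarrow> 'w measure \<Rightarrow> ereal" where
  "rel_entropy Q P =
     (if integrable Q (entropy_density (exp 1) P Q)
      then ereal (KL_divergence (exp 1) P Q) else \<infinity>)"

text \<open>In the following, \<open>P\<close> is the reference law on the path space and the terminal output
  \<open>X\<^sub>T\<close> of a path \<open>w\<close> is \<open>w T\<close>. A reward is a function on \<open>[0,1]\<close>; as an element of
  \<^typ>\<open>real \<Rightarrow> real\<close> its values outside \<open>{0..1}\<close> are irrelevant.\<close>

definition rank_rewards :: "(real \<Rightarrow> real) set" where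
  "rank_rewards = {R. mono_on {0..1} R \<and> bounded (R ` {0..1})}"

definition payoff ::
    "(real \<Rightarrow> real) measure \<Rightarrow> real \<Rightarrow> real \<Rightarrow> real \<Rightarrow> (real \<Rightarrow> real) \<Rightarrow> real measure
      \<Rightarrow> (real \<Rightarrow> real) measure \<Rightarrow> ereal" where
  "payoff P T c \<sigma> R \<mu> Q =
     ereal (\<integral>w. R (cdf \<mu> (w T)) \<partial>Q) - ereal (2 * c * \<sigma>\<^sup>2) * rel_entropy Q P"

definition player_value ::
    "(real \<Rightarrow> real) measure \<Rightarrow> real \<Rightarrow> real \<Rightarrow> real \<Rightarrow> (real \<Rightarrow> real) \<Rightarrow> real measure \<Rightarrow> ereal" where
  "player_value P T c \<sigma> R \<mu> = (SUP Q\<in>equivalent_probs P. payoff P T c \<sigma> R \<mu> Q)"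

text \<open>The optimal \<open>Q\<close> is unique when the value is finite (the relative entropy is strictly convex
  in \<open>Q\<close>), so the following is the fixed-point property of the best response mapping.\<close>

definition is_equilibrium ::
    "(real \<Rightarrow> real) measure \<Rightarrow> real \<Rightarrow> real \<Rightarrow> real \<Rightarrow> (real \<Rightarrow> real) \<Rightarrow> real measure \<Rightarrow> bool" where
  "is_equilibrium P T c \<sigma> R \<mu> \<longleftrightarrow>
     prob_space \<mu> \<and> sets \<mu> = sets borel \<and>
     (\<exists>Q\<in>equivalent_probs P.
        payoff P T c \<sigma> R \<mu> Q = player_value P T c \<sigma> R \<mu> \<and> distr Q borel (\<lambda>w. w T) = \<mu>)"

definition equilibrium ::
    "(real \<Rightarrow> real) measure \<Rightarrow> real \<Rightarrow> real \<Rightarrow> real \<Rightarrow> (real \<Rightarrow> real) \<Rightarrow> real measure" where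
  "equilibrium P T c \<sigma> R = (THE \<mu>. is_equilibrium P T c \<sigma> R \<mu>)"

definition game_value ::
    "(real \<Rightarrow> real) measure \<Rightarrow> real \<Rightarrow> real \<Rightarrow> real \<Rightarrow> (real \<Rightarrow> real) \<Rightarrow> ereal" where
  "game_value P T c \<sigma> R = player_value P T c \<sigma> R (equilibrium P T c \<sigma> R)"

section \<open>The principal's problem\<close>

definition feasible_rewards ::
    "(real \<Rightarrow> real) measure \<Rightarrow> real \<Rightarrow> real \<Rightarrow> real \<Rightarrow> real \<Rightarrow> (real \<Rightarrow> real) set" where
  "feasible_rewards P T c \<sigma> V0 = {R \<in> rank_rewards. ereal V0 \<le> game_value P T c \<sigma> R}"

definition net_profit ::
    "(real \<Rightarrow> real) measure \<Rightarrow> real \<Rightarrow> real \<Rightarrow> real \<Rightarrow> (real \<Rightarrow> real) \<Rightarrow> (real \<Rightarrow> real) \<Rightarrow> real" where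
  "net_profit P T c \<sigma> g R =
     (\<integral>y. g y \<partial>equilibrium P T c \<sigma> R) - (LBINT r:{0..1}. R r)"

text \<open>The quantile function takes the values \<open>-\<infinity>\<close> at 0 and, if \<open>cdf \<mu> < 1\<close> everywhere,
  \<open>\<infinity>\<close> at 1. A bounded increasing \<open>g\<close> is evaluated there through its limits at \<open>\<plusminus>\<infinity>\<close>, which
  are its infimum and supremum.\<close>

definition quantile :: "real measure \<Rightarrow> real \<Rightarrow> ereal" where
  "quantile \<mu> r = Inf {ereal y |y. r \<le> cdf \<mu> y}"

definition at_ereal :: "(real \<Rightarrow> real) \<Rightarrow> ereal \<Rightarrow> real" where
  "at_ereal g x = (case x of ereal y \<Rightarrow> g y | PInfty \<Rightarrow> (SUP y. g y) | MInfty \<Rightarrow> (INF y. g y))"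

end

theory Submission
  imports Defs
begin

text \<open>Write \<open>K = 2 c \<sigma>\<^sup>2\<close>, let \<open>\<nu>\<close> be the terminal law under the reference measure, and for bounded \<open>h\<close>
let the Gibbs measure of \<open>h\<close> over \<open>M\<close> be the probability measure with \<open>M\<close>-density proportional to
\<open>exp h\<close>. Everything rests on one inequality, the Gibbs variational principle
(\<open>gibbs_variational\<close>): \<open>E\<^sup>Q[h] - H(Q|M) \<le> ln (\<integral> exp h dM)\<close>, with equality exactly when \<open>Q\<close> is the Gibbs
measure of \<open>h\<close>. It is used twice, once for the players and once for the principal.

For the players it is applied on path space to \<open>h(w) = R(F\<^sub>\<mu>(w T)) / K\<close>. The best response to \<open>\<mu>\<close> is a
Gibbs measure, its terminal law is the Gibbs measure of \<open>R \<circ> F\<^sub>\<mu> / K\<close> over \<open>\<nu>\<close>, and the players' value is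
\<open>K ln C\<close> with \<open>C = \<integral> exp (R \<circ> F\<^sub>\<mu> / K) d\<nu>\<close>. Equilibria are therefore the fixed points
\<open>\<mu> = gibbs \<nu> (R \<circ> F\<^sub>\<mu> / K)\<close>. There is exactly one: \<open>F\<^sub>\<mu>\<close> pushes a fixed point \<open>\<mu>\<close> to the uniform law on
\<open>[0,1]\<close>, hence pushes \<open>\<nu> = gibbs \<mu> (- R \<circ> F\<^sub>\<mu> / K)\<close> to the Gibbs measure of \<open>- R / K\<close> over the uniform law.
If \<open>G\<close> is the distribution function of the latter, this says \<open>G \<circ> F\<^sub>\<mu> = F\<^sub>\<nu>\<close>, and \<open>G\<close> is a continuous and
strictly increasing map of \<open>[0,1]\<close> onto itself that depends on \<open>R\<close> alone
(\<open>gibbs_fixed_point_unique\<close>, \<open>gibbs_fixed_point_exists\<close>).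

For the principal, let \<open>\<mu>\<close> be the equilibrium for \<open>R\<close>. Since \<open>F\<^sub>\<mu>\<close> is uniform under \<open>\<mu>\<close>, the wage bill
\<open>\<integral> R dr\<close> equals \<open>\<integral> R \<circ> F\<^sub>\<mu> d\<mu>\<close>, and as \<open>\<mu>\<close> has density \<open>exp (R \<circ> F\<^sub>\<mu> / K) / C\<close> with respect to \<open>\<nu>\<close>, this is
\<open>K H(\<mu>|\<nu>) + K ln C\<close>. The net profit is thus \<open>K (\<integral> g / K d\<mu> - H(\<mu>|\<nu>))\<close> minus the game value. The
variational principle over \<open>\<nu>\<close> bounds the first term by \<open>K ln Z\<close>, and the participation constraint
bounds the game value below by \<open>V0\<close>. Equality forces \<open>\<mu>\<close> to be the Gibbs measure of \<open>g / K\<close> and the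
constraint to bind, which determines \<open>R \<circ> F\<^sub>\<mu>\<close> almost everywhere and so \<open>R\<close> almost everywhere on
\<open>[0,1]\<close> (\<open>net_profit_bound\<close>); conversely the stated reward satisfies the fixed-point equation with
that measure (\<open>optimal_reward_attains\<close>).\<close>

section \<open>Gibbs measures and the variational principle\<close>

lemma absolutely_continuous_trans:
  "absolutely_continuous L M \<Longrightarrow> absolutely_continuous M N \<Longrightarrow> absolutely_continuous L N"
  by (auto simp: absolutely_continuous_def)

definition gibbs :: "'a measure \<Rightarrow> ('a \<Rightarrow> real) \<Rightarrow> 'a measure" where
  "gibbs M h = density M (\<lambda>x. ennreal (exp (h x) / (\<integral>x. exp (h x) \<partial>M)))"

lemma sets_gibbs [simp, measurable_cong]: "sets (gibbs M h) = sets M"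
  by (simp add: gibbs_def)

lemma space_gibbs [simp]: "space (gibbs M h) = space M"
  by (simp add: gibbs_def)

text \<open>A density that depends on the outcome only through \<open>X\<close> survives the push-forward along \<open>X\<close>. This
reduces the game on path space to one on the real line.\<close>

lemma distr_gibbs:
  assumes [measurable]: "X \<in> measurable M N" "h \<in> borel_measurable N"
  shows "distr (gibbs M (\<lambda>x. h (X x))) N X = gibbs (distr M N X) h"
proof (rule measure_eqI)
  fix A assume "A \<in> sets (distr (gibbs M (\<lambda>x. h (X x))) N X)"
  then have [measurable]: "A \<in> sets N" by simp
  have "X -` A \<inter> space M \<in> sets M" by measurable
  then show "emeasure (distr (gibbs M (\<lambda>x. h (X x))) N X) A = emeasure (gibbs (distr M N X) h) A"
    unfolding gibbs_def
    by (auto simp: emeasure_distr emeasure_density integral_distr nn_integral_distr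
        intro!: nn_integral_cong split: split_indicator)
qed simp

context prob_space
begin

lemma integrable_bounded:
  fixes h :: "'a \<Rightarrow> real"
  assumes "h \<in> borel_measurable M" "bounded (range h)"
  shows "integrable M h"
proof -
  obtain b where "\<And>x. \<bar>h x\<bar> \<le> b"
    using assms(2) by (auto simp: bounded_iff)
  then show ?thesis
    using assms(1) by (intro integrable_const_bound[where B=b]) auto
qed

lemma integrable_exp:
  fixes h :: "'a \<Rightarrow> real"
  assumes [measurable]: "h \<in> borel_measurable M" and "bounded (range h)"
  shows "integrable M (\<lambda>x. exp (h x))"
proof -
  obtain b where "\<And>x. \<bar>h x\<bar> \<le> b"
    using assms(2) by (auto simp: bounded_iff)
  then have "\<And>x. h x \<le> b" by (meson abs_le_D1)
  then show ?thesis
    by (intro integrable_const_bound[where B="exp b"]) auto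
qed

lemma integral_exp_pos:
  fixes h :: "'a \<Rightarrow> real"
  assumes "h \<in> borel_measurable M" and "bounded (range h)"
  shows "0 < (\<integral>x. exp (h x) \<partial>M)"
  using expectation_less[of "\<lambda>x. - exp (h x)" 0] integrable_exp[OF assms] by auto

lemma gibbs_equivalent:
  assumes [measurable]: "h \<in> borel_measurable M" and "bounded (range h)"
  shows "gibbs M h \<in> equivalent_probs M"
proof -
  let ?C = "\<integral>x. exp (h x) \<partial>M"
  note C = integral_exp_pos[OF assms]
  have "emeasure (gibbs M h) (space M) = (\<integral>\<^sup>+x. ennreal (exp (h x) / ?C) \<partial>M)"
    by (simp add: gibbs_def emeasure_density cong: nn_integral_cong)
  also have "\<dots> = ennreal (\<integral>x. exp (h x) / ?C \<partial>M)"
    using C integrable_exp[OF assms] by (intro nn_integral_eq_integral) auto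
  also have "\<dots> = 1" using C by simp
  finally have "prob_space (gibbs M h)" by (intro prob_spaceI) simp
  moreover have "absolutely_continuous M (gibbs M h)"
    unfolding gibbs_def by (intro absolutely_continuousI_density) auto
  moreover have "absolutely_continuous (gibbs M h) M"
    unfolding absolutely_continuous_def
  proof
    fix A assume "A \<in> null_sets (gibbs M h)"
    then have "A \<in> sets M" and "AE x in M. x \<in> A \<longrightarrow> exp (h x) / ?C \<le> 0"
      by (auto simp: gibbs_def null_sets_density_iff ennreal_eq_0_iff)
    moreover have "\<not> exp (h x) / ?C \<le> 0" for x using C by (simp add: not_le)
    ultimately show "A \<in> null_sets M" by (simp add: AE_iff_null_sets)
  qed
  ultimately show ?thesis by (simp add: equivalent_probs_def)
qed

lemma prob_space_gibbs:
  "h \<in> borel_measurable M \<Longrightarrow> bounded (range h) \<Longrightarrow> prob_space (gibbs M h)"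
  using gibbs_equivalent by (simp add: equivalent_probs_def)

lemma integral_gibbs:
  fixes f :: "'a \<Rightarrow> real"
  assumes [measurable]: "h \<in> borel_measurable M" "f \<in> borel_measurable M" and "bounded (range h)"
  shows "(\<integral>x. f x \<partial>gibbs M h) = (\<integral>x. exp (h x) * f x \<partial>M) / (\<integral>x. exp (h x) \<partial>M)"
proof -
  have "0 < (\<integral>x. exp (h x) \<partial>M)" using integral_exp_pos assms by blast
  then show ?thesis unfolding gibbs_def
    by (subst integral_density) (auto intro!: AE_I2)
qed

lemma gibbs_add_const:
  assumes "h \<in> borel_measurable M" "bounded (range h)"
  shows "gibbs M (\<lambda>x. h x + a) = gibbs M h"
    and "ln (\<integral>x. exp (h x + a) \<partial>M) = ln (\<integral>x. exp (h x) \<partial>M) + a"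
  using integral_exp_pos[OF assms] by (simp_all add: gibbs_def exp_add ln_mult)

lemma gibbs_gibbs_uminus:
  assumes [measurable]: "h \<in> borel_measurable M" and "bounded (range h)"
  shows "gibbs (gibbs M h) (\<lambda>x. - h x) = M"
proof -
  let ?C = "\<integral>x. exp (h x) \<partial>M"
  note C = integral_exp_pos[OF assms]
  have "(\<integral>x. exp (- h x) \<partial>gibbs M h) = 1 / ?C"
    using assms by (subst integral_gibbs) (auto simp: prob_space simp flip: exp_add)
  then have "gibbs (gibbs M h) (\<lambda>x. - h x) = density (gibbs M h) (\<lambda>x. ennreal (exp (- h x) * ?C))"
    by (simp add: gibbs_def[of "gibbs M h"])
  also have "\<dots> = density M (\<lambda>x. 1)"
    unfolding gibbs_def using C
    by (subst density_density_eq)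
       (auto simp flip: ennreal_mult' ennreal_mult'' simp: exp_minus intro!: density_cong)
  finally show ?thesis by (simp add: density_1)
qed

lemma gibbs_eq_imp_AE:
  assumes [measurable]: "h \<in> borel_measurable M" "k \<in> borel_measurable M"
    and "bounded (range h)" "bounded (range k)" "gibbs M h = gibbs M k"
  shows "AE x in M. h x - ln (\<integral>x. exp (h x) \<partial>M) = k x - ln (\<integral>x. exp (k x) \<partial>M)"
proof -
  have Ch: "0 < (\<integral>x. exp (h x) \<partial>M)" and Ck: "0 < (\<integral>x. exp (k x) \<partial>M)"
    using integral_exp_pos assms by blast+
  have "AE x in M. ennreal (exp (h x) / (\<integral>x. exp (h x) \<partial>M)) = ennreal (exp (k x) / (\<integral>x. exp (k x) \<partial>M))"
    using assms(5) unfolding gibbs_def by (intro density_unique) auto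
  then show ?thesis
  proof eventually_elim
    case (elim x)
    then have "ln (exp (h x) / (\<integral>x. exp (h x) \<partial>M)) = ln (exp (k x) / (\<integral>x. exp (k x) \<partial>M))"
      using Ch Ck by simp
    then show ?case using Ch Ck by (simp add: ln_div)
  qed
qed

lemma rel_entropy_gibbs:
  assumes [measurable]: "h \<in> borel_measurable M" and "bounded (range h)"
  shows "rel_entropy (gibbs M h) M = ereal ((\<integral>x. h x \<partial>gibbs M h) - ln (\<integral>x. exp (h x) \<partial>M))"
proof -
  let ?C = "\<integral>x. exp (h x) \<partial>M"
  interpret Q: prob_space "gibbs M h" using assms by (rule prob_space_gibbs)
  note C = integral_exp_pos[OF assms]
  have "AE x in M. ennreal (exp (h x) / ?C) = RN_deriv M (gibbs M h) x"
    by (intro RN_deriv_unique) (auto simp: gibbs_def)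
  then have "AE x in M. entropy_density (exp 1) M (gibbs M h) x = h x - ln ?C"
  proof eventually_elim
    case (elim x)
    have "enn2real (RN_deriv M (gibbs M h) x) = exp (h x) / ?C"
      unfolding elim[symmetric] using C by simp
    then show ?case using C by (simp add: entropy_density_def log_def ln_div)
  qed
  then have *: "AE x in gibbs M h. entropy_density (exp 1) M (gibbs M h) x = h x - ln ?C"
    using gibbs_equivalent[OF assms]
    by (auto simp: equivalent_probs_def intro: absolutely_continuous_AE[rotated 2])
  have "h \<in> borel_measurable (gibbs M h)" by measurable
  then have i: "integrable (gibbs M h) h" using assms by (intro Q.integrable_bounded) auto
  have m: "entropy_density (exp 1) M (gibbs M h) \<in> borel_measurable (gibbs M h)" by measurable
  have "integrable (gibbs M h) (entropy_density (exp 1) M (gibbs M h)) \<longleftrightarrow>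
     integrable (gibbs M h) (\<lambda>x. h x - ln ?C)"
    by (intro integrable_cong_AE m *) auto
  moreover have "KL_divergence (exp 1) M (gibbs M h) = (\<integral>x. h x - ln ?C \<partial>gibbs M h)"
    unfolding KL_divergence_def by (intro integral_cong_AE m *) auto
  ultimately show ?thesis using i by (auto simp: rel_entropy_def Q.prob_space[simplified])
qed

text \<open>With \<open>D = dQ/dM\<close> and \<open>r = (exp h / C) / D\<close>, where \<open>C = \<integral> exp h dM\<close>, the deficit
\<open>ln C - (E\<^sup>Q[h] - H(Q|M))\<close> is \<open>E\<^sup>Q[- ln r]\<close>. As \<open>Q\<close> and \<open>M\<close> are equivalent, \<open>E\<^sup>Q[r] = 1\<close>, so the deficit equals
\<open>E\<^sup>Q[r - 1 - ln r]\<close>, whose integrand is nonnegative and vanishes only at \<open>r = 1\<close>, that is, where \<open>D\<close> is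
the Gibbs density. When the entropy is infinite the left-hand side is \<open>-\<infinity>\<close>.\<close>

lemma gibbs_variational:
  assumes [measurable]: "h \<in> borel_measurable M" and bdd: "bounded (range h)"
    and Q: "Q \<in> equivalent_probs M"
  shows "ereal (\<integral>x. h x \<partial>Q) - rel_entropy Q M \<le> ereal (ln (\<integral>x. exp (h x) \<partial>M))"
    and "ereal (\<integral>x. h x \<partial>Q) - rel_entropy Q M = ereal (ln (\<integral>x. exp (h x) \<partial>M)) \<longleftrightarrow> Q = gibbs M h"
proof -
  let ?C = "\<integral>x. exp (h x) \<partial>M"
  let ?E = "entropy_density (exp 1) M Q"
  have sets [simp, measurable_cong]: "sets Q = sets M" and ac: "absolutely_continuous M Q" "absolutely_continuous Q M"
    using Q by (auto simp: equivalent_probs_def)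
  interpret Q: prob_space Q using Q by (simp add: equivalent_probs_def)
  note C = integral_exp_pos[OF assms(1,2)]
  obtain D where D: "D \<in> borel_measurable M" "AE x in M. RN_deriv M Q x = ennreal (D x)"
    "AE x in Q. 0 < D x" "\<And>x. 0 \<le> D x"
    using real_RN_deriv[OF Q.finite_measure_axioms ac(1)] by auto
  note [measurable] = D(1)
  have QD: "Q = density M (\<lambda>x. ennreal (D x))"
  proof -
    have "density M (RN_deriv M Q) = density M (\<lambda>x. ennreal (D x))"
      using D(2) by (intro density_cong) auto
    then show ?thesis using density_RN_deriv[OF ac(1) sets] by simp
  qed
  have Dpos: "AE x in M. 0 < D x"
    using D(3) by (intro absolutely_continuous_AE[OF _ ac(2)]) auto
  have E: "AE x in Q. ?E x = ln (D x)"
  proof -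
    have "AE x in Q. RN_deriv M Q x = ennreal (D x)"
      using D(2) by (intro absolutely_continuous_AE[OF _ ac(1)]) auto
    then show ?thesis by eventually_elim (simp add: entropy_density_def log_def D(4))
  qed
  have h: "integrable Q h"
    using bdd by (intro Q.integrable_bounded) auto
  define r where "r x = exp (h x) / ?C / D x" for x
  have r_int: "integrable Q r" and r_eq: "(\<integral>x. r x \<partial>Q) = 1"
  proof -
    have [measurable]: "r \<in> borel_measurable M" unfolding r_def by measurable
    have *: "AE x in M. D x * r x = exp (h x) / ?C"
      using Dpos by eventually_elim (simp add: r_def)
    have "integrable M (\<lambda>x. D x * r x) \<longleftrightarrow> integrable M (\<lambda>x. exp (h x) / ?C)"
      by (intro integrable_cong_AE *) auto
    then show "integrable Q r"
      unfolding QD using D(4) integrable_exp[OF assms(1,2)] by (subst integrable_density) auto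
    have "(\<integral>x. r x \<partial>Q) = (\<integral>x. D x * r x \<partial>M)"
      unfolding QD using D(4) by (subst integral_density) auto
    also have "\<dots> = (\<integral>x. exp (h x) / ?C \<partial>M)"
      by (intro integral_cong_AE *) auto
    finally show "(\<integral>x. r x \<partial>Q) = 1" using C by simp
  qed
  \<comment> \<open>The integrand of the deficit is \<open>- ln r\<close>; adding \<open>r - 1\<close>, which has \<open>Q\<close>-mean 0, makes it nonnegative.\<close>
  have gap: "AE x in Q. h x - ln ?C - ?E x = ln (r x) \<and> 0 < r x"
    using E D(3) by eventually_elim (use C in \<open>auto simp: r_def ln_div ln_mult\<close>)
  have gap_nonneg: "AE x in Q. 0 \<le> r x - 1 - (h x - ln ?C - ?E x)"
    using gap by eventually_elim (simp add: ln_le_minus_one)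
  have *: "(\<integral>x. h x \<partial>Q) - KL_divergence (exp 1) M Q \<le> ln ?C \<and>
     ((\<integral>x. h x \<partial>Q) - KL_divergence (exp 1) M Q = ln ?C \<longrightarrow> Q = gibbs M h)" if i: "integrable Q ?E"
  proof -
    have gi: "integrable Q (\<lambda>x. r x - 1 - (h x - ln ?C - ?E x))" using i h r_int by auto
    have eq: "(\<integral>x. r x - 1 - (h x - ln ?C - ?E x) \<partial>Q) =
        ln ?C - ((\<integral>x. h x \<partial>Q) - KL_divergence (exp 1) M Q)"
      using i h r_int by (simp add: r_eq Q.prob_space KL_divergence_def)
    have "Q = gibbs M h" if "(\<integral>x. h x \<partial>Q) - KL_divergence (exp 1) M Q = ln ?C"
    proof -
      have "AE x in Q. r x - 1 - (h x - ln ?C - ?E x) = 0"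
        using integral_nonneg_eq_0_iff_AE[OF gi gap_nonneg] eq that by simp
      with gap D(3) have "AE x in Q. D x = exp (h x) / ?C"
      proof eventually_elim
        case (elim x)
        then have "r x = 1" by (intro ln_eq_minus_one) auto
        then show ?case using elim by (simp add: r_def field_simps)
      qed
      then have "AE x in M. D x = exp (h x) / ?C"
        by (intro absolutely_continuous_AE[OF _ ac(2)]) auto
      then have "density M (\<lambda>x. ennreal (D x)) = gibbs M h"
        unfolding gibbs_def by (intro density_cong) auto
      then show ?thesis using QD by simp
    qed
    then show ?thesis
      using integral_nonneg_AE[OF gap_nonneg] eq by auto
  qed
  show "ereal (\<integral>x. h x \<partial>Q) - rel_entropy Q M \<le> ereal (ln ?C)"
    using * by (auto simp: rel_entropy_def)
  show "ereal (\<integral>x. h x \<partial>Q) - rel_entropy Q M = ereal (ln ?C) \<longleftrightarrow> Q = gibbs M h"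
  proof
    assume "ereal (\<integral>x. h x \<partial>Q) - rel_entropy Q M = ereal (ln ?C)"
    then show "Q = gibbs M h" using * by (auto simp: rel_entropy_def split: if_splits)
  next
    assume "Q = gibbs M h"
    then show "ereal (\<integral>x. h x \<partial>Q) - rel_entropy Q M = ereal (ln ?C)"
      using rel_entropy_gibbs[OF assms(1,2)] by simp
  qed
qed

end

lemma real_distribution_gibbs:
  assumes "real_distribution \<nu>" "h \<in> borel_measurable borel" "bounded (range h)"
  shows "real_distribution (gibbs \<nu> h)"
proof -
  interpret real_distribution \<nu> by fact
  interpret Q: prob_space "gibbs \<nu> h" using assms(2,3) by (intro prob_space_gibbs) auto
  show ?thesis by unfold_locales auto
qed

section \<open>Distribution functions and the uniform law\<close>

abbreviation unit_uniform :: "real measure" where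
  "unit_uniform \<equiv> uniform_measure lborel {0..1}"

lemma real_distribution_unit_uniform: "real_distribution unit_uniform"
proof -
  interpret prob_space unit_uniform by (rule prob_space_uniform_measure) auto
  show ?thesis by unfold_locales auto
qed

lemma cdf_unit_uniform: "cdf unit_uniform r = max 0 (min 1 r)"
proof -
  have "{0..1} \<inter> {..r} = (if r < 0 then {} else {0..min 1 r})" by auto
  then show ?thesis by (auto simp: cdf_def2 measure_uniform_measure)
qed

lemma absolutely_continuous_unit_uniform: "absolutely_continuous lborel unit_uniform"
  unfolding uniform_measure_def by (intro absolutely_continuousI_density) auto

lemma integral_unit_uniform:
  fixes f :: "real \<Rightarrow> real"
  assumes [measurable]: "f \<in> borel_measurable borel"
  shows "(\<integral>r. f r \<partial>unit_uniform) = (LBINT r:{0..1}. f r)"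
proof -
  have "unit_uniform = density lborel (\<lambda>r. ennreal (indicator {0..1} r))"
    by (simp add: uniform_measure_def ennreal_indicator divide_ennreal_def)
  then show ?thesis
    by (simp add: integral_density set_lebesgue_integral_def)
qed

context real_distribution
begin

lemma measurable_cdf [measurable]: "cdf M \<in> borel_measurable borel"
  by (intro borel_measurable_mono) (simp add: mono_def cdf_nondecreasing)

lemma cdf_in_unit: "cdf M x \<in> {0..1}"
  using cdf_nonneg cdf_bounded_prob by simp

lemma isCont_cdf_of_ac:
  assumes "absolutely_continuous lborel M"
  shows "isCont (cdf M) x"
proof -
  have "{x} \<in> null_sets M"
    using assms finite_imp_null_set_lborel[of "{x}"] by (auto simp: absolutely_continuous_def)
  then show ?thesis by (simp add: isCont_cdf measure_eq_0_null_sets)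
qed

lemma strict_mono_cdf_of_ac:
  assumes "absolutely_continuous M lborel"
  shows "strict_mono (cdf M)"
proof (rule strict_monoI)
  fix a b :: real assume "a < b"
  have "cdf M a \<noteq> cdf M b"
  proof
    assume "cdf M a = cdf M b"
    then have "measure M {a<..b} = 0" using cdf_diff_eq[OF \<open>a < b\<close>] by simp
    then have "{a<..b} \<in> null_sets M" by (simp add: null_sets_def emeasure_eq_measure)
    then have "{a<..b} \<in> null_sets lborel" using assms by (auto simp: absolutely_continuous_def)
    then show False using \<open>a < b\<close> by (simp add: null_sets_def)
  qed
  then show "cdf M a < cdf M b" using cdf_nondecreasing[of a b] \<open>a < b\<close> by simp
qed

lemma cdf_attains:
  assumes "\<And>x. isCont (cdf M) x" "0 < r" "r < 1"
  obtains y where "cdf M y = r"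
proof -
  have "eventually (\<lambda>x. cdf M x < r) at_bot" "eventually (\<lambda>x. r < cdf M x) at_top"
    using order_tendstoD[OF cdf_lim_at_bot] order_tendstoD[OF cdf_lim_at_top_prob] assms by auto
  then obtain a b where ab: "cdf M a < r" "r < cdf M b"
    by (auto simp: eventually_at_bot_linorder eventually_at_top_linorder)
  then have "a \<le> b" using cdf_nondecreasing[of b a] by (cases "a \<le> b") auto
  then have "\<exists>y\<ge>a. y \<le> b \<and> cdf M y = r"
    using ab assms(1) by (intro IVT) auto
  then show ?thesis using that by blast
qed

text \<open>The set \<open>{z. cdf M z \<le> r}\<close> lies between half-lines \<open>{..y}\<close> with \<open>cdf M y = r\<close> and with \<open>cdf M y = s\<close>,
\<open>s > r\<close>; continuity supplies such points \<open>y\<close> for all levels strictly between 0 and 1.\<close>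

lemma measure_cdf_le:
  assumes cont: "\<And>x. isCont (cdf M) x" and r: "0 \<le> r" "r \<le> 1"
  shows "measure M {z. cdf M z \<le> r} = r"
proof (rule antisym)
  show "measure M {z. cdf M z \<le> r} \<le> r"
  proof (cases "r = 1")
    case False
    then have "r < 1" using r by simp
    then show ?thesis
    proof (rule dense_ge_bounded)
      fix s assume s: "r < s" "s < 1"
      then obtain y where y: "cdf M y = s" using cdf_attains[OF cont, of s] r by auto
      have "{z. cdf M z \<le> r} \<subseteq> {..y}"
        using s y cdf_nondecreasing by (auto simp: not_le[symmetric]) (metis le_cases not_le order_trans)
      then have "measure M {z. cdf M z \<le> r} \<le> measure M {..y}"
        by (intro finite_measure_mono) auto
      then show "measure M {z. cdf M z \<le> r} \<le> s" using y by (simp add: cdf_def2)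
    qed
  qed simp
  show "r \<le> measure M {z. cdf M z \<le> r}"
  proof (cases "r = 1")
    case True
    then have "{z. cdf M z \<le> r} = space M" using cdf_bounded_prob by auto
    then show ?thesis using True prob_space by simp
  next
    case False
    show ?thesis
    proof (cases "r = 0")
      case False
      with \<open>r \<noteq> 1\<close> obtain y where y: "cdf M y = r" using cdf_attains[OF cont, of r] r by auto
      have "measure M {..y} \<le> measure M {z. cdf M z \<le> r}"
        using y cdf_nondecreasing by (intro finite_measure_mono) auto
      then show ?thesis using y by (simp add: cdf_def2)
    qed simp
  qed
qed

text \<open>The probability integral transform. It turns the integral of a rank-based reward over ranks into
an expectation under any atomless output distribution.\<close>

lemma distr_cdf_eq_unit_uniform:
  assumes "\<And>x. isCont (cdf M) x"
  shows "distr M borel (cdf M) = unit_uniform"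
proof (rule cdf_unique)
  show "real_distribution unit_uniform" by (rule real_distribution_unit_uniform)
  show "real_distribution (distr M borel (cdf M))" by simp
  show "cdf (distr M borel (cdf M)) = cdf unit_uniform"
  proof
    fix r
    have *: "cdf (distr M borel (cdf M)) r = measure M {z. cdf M z \<le> r}"
      by (simp add: cdf_def2 measure_distr vimage_def)
    consider "r < 0" | "0 \<le> r" "r \<le> 1" | "1 < r" by linarith
    then show "cdf (distr M borel (cdf M)) r = cdf unit_uniform r"
    proof cases
      case 1
      then have "{z. cdf M z \<le> r} = {}" using cdf_nonneg by (auto simp: not_le intro: less_le_trans)
      then show ?thesis using 1 by (simp add: * cdf_unit_uniform)
    next
      case 2
      then show ?thesis using measure_cdf_le[OF assms] by (simp add: * cdf_unit_uniform)
    next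
      case 3
      then have "{z. cdf M z \<le> r} = space M" using cdf_bounded_prob by (auto intro: order_trans less_imp_le)
      then show ?thesis using 3 prob_space by (simp add: * cdf_unit_uniform)
    qed
  qed
qed

text \<open>Ranks order outputs faithfully outside a null set, even where the distribution function is flat:
\<open>{..y}\<close> is contained in \<open>{z. cdf M z \<le> cdf M y}\<close>, and both have measure \<open>cdf M y\<close>.\<close>

lemma AE_cdf_le_iff:
  assumes "\<And>x. isCont (cdf M) x"
  shows "AE z in M. cdf M z \<le> cdf M y \<longleftrightarrow> z \<le> y"
proof -
  have sub: "{..y} \<subseteq> {z. cdf M z \<le> cdf M y}" using cdf_nondecreasing by auto
  have meas: "{z. cdf M z \<le> cdf M y} \<in> sets M" by measurable
  have "measure M ({z. cdf M z \<le> cdf M y} - {..y}) = measure M {z. cdf M z \<le> cdf M y} - cdf M y"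
    using meas sub by (simp add: finite_measure_Diff cdf_def2)
  also have "\<dots> = 0"
    using measure_cdf_le[OF assms, of "cdf M y"] cdf_in_unit[of y] by simp
  finally have "measure M ({z. cdf M z \<le> cdf M y} - {..y}) = 0" .
  then have "AE z in M. z \<notin> {z. cdf M z \<le> cdf M y} - {..y}"
    using meas by (intro AE_not_in) (auto simp: null_sets_def emeasure_eq_measure)
  then show ?thesis
    by eventually_elim (use cdf_nondecreasing in auto)
qed

end

section \<open>Fixed points of the Gibbs map\<close>

text \<open>These properties make the distribution function of a Gibbs measure over the uniform law an
increasing bijection of the unit interval, which can be inverted to solve the fixed-point equation.\<close>

lemma cdf_gibbs_unit_uniform:
  fixes k :: "real \<Rightarrow> real"
  assumes [measurable]: "k \<in> borel_measurable borel" and bdd: "bounded (range k)"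
  defines "\<upsilon> \<equiv> gibbs unit_uniform k"
  shows "isCont (cdf \<upsilon>) x" and "strict_mono_on {0..1} (cdf \<upsilon>)" and "cdf \<upsilon> 0 = 0" and "cdf \<upsilon> 1 = 1"
proof -
  interpret U: real_distribution unit_uniform by (rule real_distribution_unit_uniform)
  interpret V: real_distribution \<upsilon> unfolding \<upsilon>_def
    using bdd by (intro real_distribution_gibbs real_distribution_unit_uniform) auto
  have ac: "absolutely_continuous unit_uniform \<upsilon>" "absolutely_continuous \<upsilon> unit_uniform"
    using U.gibbs_equivalent[of k] bdd by (auto simp: \<upsilon>_def equivalent_probs_def)
  then have "absolutely_continuous lborel \<upsilon>"
    using absolutely_continuous_unit_uniform absolutely_continuous_trans by blast
  then show "isCont (cdf \<upsilon>) x" by (rule V.isCont_cdf_of_ac)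
  have null_iff: "measure \<upsilon> A = 0 \<longleftrightarrow> measure unit_uniform A = 0" if "A \<in> sets borel" for A
  proof -
    have "A \<in> null_sets \<upsilon> \<longleftrightarrow> A \<in> null_sets unit_uniform"
      using ac by (auto simp: absolutely_continuous_def)
    moreover have "A \<in> sets \<upsilon>" "A \<in> sets unit_uniform" using that by (auto simp: \<upsilon>_def)
    ultimately show ?thesis
      by (simp add: null_sets_def V.emeasure_eq_measure U.emeasure_eq_measure del: measure_uniform_measure)
  qed
  show "strict_mono_on {0..1} (cdf \<upsilon>)"
  proof (rule strict_mono_onI)
    fix a b :: real assume ab: "a \<in> {0..1}" "b \<in> {0..1}" "a < b"
    have "measure unit_uniform {a<..b} \<noteq> 0"
      using ab U.cdf_diff_eq[of a b] by (simp add: cdf_unit_uniform)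
    then have "measure \<upsilon> {a<..b} \<noteq> 0" by (simp add: null_iff del: measure_uniform_measure)
    then show "cdf \<upsilon> a < cdf \<upsilon> b"
      using V.cdf_diff_eq[OF \<open>a < b\<close>] measure_nonneg[of \<upsilon> "{a<..b}"] by linarith
  qed
  have "measure unit_uniform {..0} = 0"
    using cdf_unit_uniform[of 0] by (simp add: cdf_def2 del: measure_uniform_measure)
  then show "cdf \<upsilon> 0 = 0" by (simp add: cdf_def2 null_iff del: measure_uniform_measure)
  have "measure unit_uniform {1<..} = 1 - measure unit_uniform {..1}"
    using U.prob_compl[of "{..1}"] by (simp add: Compl_eq_Diff_UNIV[symmetric] del: measure_uniform_measure)
  also have "\<dots> = 0"
    using cdf_unit_uniform[of 1] by (simp add: cdf_def2 del: measure_uniform_measure)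
  finally have "measure \<upsilon> {1<..} = 0" by (simp add: null_iff del: measure_uniform_measure)
  moreover have "measure \<upsilon> {1<..} = 1 - measure \<upsilon> {..1}"
    using V.prob_compl[of "{..1}"] by (simp add: Compl_eq_Diff_UNIV[symmetric])
  ultimately show "cdf \<upsilon> 1 = 1" by (simp add: cdf_def2)
qed

text \<open>The fixed-point equation becomes explicit in terms of distribution functions: inverting it gives
\<open>\<nu> = gibbs \<mu> (- S \<circ> F\<^sub>\<mu>)\<close>, and pushing this forward along \<open>F\<^sub>\<mu>\<close>, which is uniform under \<open>\<mu>\<close>, shows that \<open>F\<^sub>\<mu>\<close>
maps \<open>\<nu>\<close> to a measure that depends on \<open>S\<close> alone.\<close>

lemma gibbs_fixed_point_cdf:
  assumes \<nu>: "real_distribution \<nu>" "absolutely_continuous lborel \<nu>"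
    and S [measurable]: "S \<in> borel_measurable borel" and bdd: "bounded (range S)"
    and \<mu>: "real_distribution \<mu>" "\<mu> = gibbs \<nu> (\<lambda>y. S (cdf \<mu> y))"
  shows "cdf (gibbs unit_uniform (\<lambda>r. - S r)) (cdf \<mu> y) = cdf \<nu> y"
proof -
  interpret N: real_distribution \<nu> by fact
  interpret M: real_distribution \<mu> by fact
  have bdd': "bounded (range (\<lambda>y. S (cdf \<mu> y)))" using bdd by (rule bounded_subset) auto
  have h: "(\<lambda>y. S (cdf \<mu> y)) \<in> borel_measurable \<nu>" by measurable
  have ac: "absolutely_continuous \<nu> \<mu>" "absolutely_continuous \<mu> \<nu>"
    using N.gibbs_equivalent[OF h bdd'] \<mu>(2) by (auto simp: equivalent_probs_def)
  have cont: "isCont (cdf \<mu>) x" for x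
    using absolutely_continuous_trans[OF \<nu>(2) ac(1)] by (rule M.isCont_cdf_of_ac)
  have "distr \<nu> borel (cdf \<mu>) = distr (gibbs \<mu> (\<lambda>y. - S (cdf \<mu> y))) borel (cdf \<mu>)"
    using N.gibbs_gibbs_uminus[OF h bdd'] \<mu>(2) by simp
  also have "\<dots> = gibbs unit_uniform (\<lambda>r. - S r)"
    using M.distr_cdf_eq_unit_uniform[OF cont] by (subst distr_gibbs) auto
  finally have push: "gibbs unit_uniform (\<lambda>r. - S r) = distr \<nu> borel (cdf \<mu>)" by simp
  have "cdf (gibbs unit_uniform (\<lambda>r. - S r)) (cdf \<mu> y) = measure \<nu> {z. cdf \<mu> z \<le> cdf \<mu> y}"
    unfolding push cdf_def2[of "distr _ _ _"] by (simp add: measure_distr vimage_def)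
  also have "\<dots> = measure \<nu> {..y}"
  proof (rule N.finite_measure_eq_AE)
    show "AE z in \<nu>. z \<in> {z. cdf \<mu> z \<le> cdf \<mu> y} \<longleftrightarrow> z \<in> {..y}"
      using absolutely_continuous_AE[OF _ ac(2) M.AE_cdf_le_iff[OF cont, of y]] by simp
  qed auto
  finally show ?thesis by (simp add: cdf_def2)
qed

lemma gibbs_fixed_point_unique:
  assumes \<nu>: "real_distribution \<nu>" "absolutely_continuous lborel \<nu>"
    and S: "S \<in> borel_measurable borel" "bounded (range S)"
    and \<mu>: "real_distribution \<mu>" "\<mu> = gibbs \<nu> (\<lambda>y. S (cdf \<mu> y))"
    and \<mu>': "real_distribution \<mu>'" "\<mu>' = gibbs \<nu> (\<lambda>y. S (cdf \<mu>' y))"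
  shows "\<mu> = \<mu>'"
proof (rule cdf_unique[OF \<mu>(1) \<mu>'(1)], rule ext)
  fix y
  let ?G = "cdf (gibbs unit_uniform (\<lambda>r. - S r))"
  have "?G (cdf \<mu> y) = ?G (cdf \<mu>' y)"
    using gibbs_fixed_point_cdf[OF \<nu> S \<mu>] gibbs_fixed_point_cdf[OF \<nu> S \<mu>'] by simp
  moreover have "strict_mono_on {0..1} ?G"
    using S by (intro cdf_gibbs_unit_uniform) (auto simp: bounded_iff)
  ultimately show "cdf \<mu> y = cdf \<mu>' y"
    using real_distribution.cdf_in_unit[OF \<mu>(1)] real_distribution.cdf_in_unit[OF \<mu>'(1)]
    by (metis strict_mono_on_eqD)
qed

text \<open>Let \<open>F\<close> be the unique solution of \<open>G \<circ> F = cdf \<nu>\<close>, where \<open>G\<close> is the distribution function of the Gibbs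
measure of \<open>- S\<close> over the uniform law. Then \<open>gibbs \<nu> (S \<circ> F)\<close> is a fixed point as soon as \<open>F\<close> is its
distribution function. This holds because \<open>F\<close> maps \<open>\<nu>\<close> to \<open>gibbs unit_uniform (- S)\<close>, so that it maps
\<open>gibbs \<nu> (S \<circ> F)\<close> to the uniform law.\<close>

lemma gibbs_fixed_point_exists:
  assumes \<nu>: "real_distribution \<nu>" "absolutely_continuous lborel \<nu>"
    and S [measurable]: "S \<in> borel_measurable borel" and bdd: "bounded (range S)"
  obtains \<mu> where "real_distribution \<mu>" "\<mu> = gibbs \<nu> (\<lambda>y. S (cdf \<mu> y))"
proof -
  let ?\<upsilon> = "gibbs unit_uniform (\<lambda>r. - S r)"
  interpret N: real_distribution \<nu> by fact
  interpret U: real_distribution unit_uniform by (rule real_distribution_unit_uniform)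
  have neg: "(\<lambda>r. - S r) \<in> borel_measurable borel" "bounded (range (\<lambda>r. - S r))"
    using bdd by (auto simp: bounded_iff)
  interpret V: real_distribution ?\<upsilon>
    using neg by (intro real_distribution_gibbs real_distribution_unit_uniform)
  note G = cdf_gibbs_unit_uniform[OF neg]
  have contN: "isCont (cdf \<nu>) x" for x using \<nu>(2) by (rule N.isCont_cdf_of_ac)
  have "\<exists>x\<ge>0. x \<le> 1 \<and> cdf ?\<upsilon> x = cdf \<nu> y" for y
    using G N.cdf_in_unit[of y] by (intro IVT) auto
  then obtain F where F: "F y \<in> {0..1}" "cdf ?\<upsilon> (F y) = cdf \<nu> y" for y
    by (metis atLeastAtMost_iff)
  \<comment> \<open>The Galois connection between \<open>F\<close> and the distribution function of \<open>?\<upsilon>\<close>, since \<open>F\<close> is \<open>cdf \<nu>\<close> followed by the inverse of the latter.\<close>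
  have F_le_iff: "F y \<le> x \<longleftrightarrow> cdf \<nu> y \<le> cdf ?\<upsilon> x" if "x \<in> {0..1}" for x y
    using strict_mono_on_less_eq[OF G(2) F(1) that, of y] F(2) by simp
  have "mono F"
    using F_le_iff[OF F(1)] N.cdf_nondecreasing by (auto simp: mono_def F(2))
  then have [measurable]: "F \<in> borel_measurable borel" by (rule borel_measurable_mono)
  let ?h = "\<lambda>y. S (F y)"
  let ?\<mu> = "gibbs \<nu> ?h"
  have h: "?h \<in> borel_measurable \<nu>" "bounded (range ?h)"
    using bdd by (auto intro: bounded_subset)
  interpret M: real_distribution ?\<mu>
    using h by (intro real_distribution_gibbs \<nu>) auto
  have "distr \<nu> borel F = ?\<upsilon>"
  proof (rule cdf_unique)
    show "real_distribution ?\<upsilon>" by (rule V.real_distribution_axioms)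
    show "real_distribution (distr \<nu> borel F)" by simp
    show "cdf (distr \<nu> borel F) = cdf ?\<upsilon>"
    proof
      fix r
      have *: "cdf (distr \<nu> borel F) r = measure \<nu> {z. F z \<le> r}"
        by (simp add: cdf_def2 measure_distr vimage_def)
      consider "r < 0" | "r \<in> {0..1}" | "1 < r" by fastforce
      then show "cdf (distr \<nu> borel F) r = cdf ?\<upsilon> r"
      proof cases
        case 1
        then have "{z. F z \<le> r} = {}" using F(1) by (auto simp: not_le intro: less_le_trans)
        moreover have "cdf ?\<upsilon> r \<le> cdf ?\<upsilon> 0" using 1 by (intro V.cdf_nondecreasing) simp
        ultimately show ?thesis using V.cdf_nonneg[of r] by (simp add: * G(3))
      next
        case 2
        then show ?thesis
          using N.measure_cdf_le[OF contN, of "cdf ?\<upsilon> r"] V.cdf_in_unit[of r]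
          by (simp add: * F_le_iff)
      next
        case 3
        then have "{z. F z \<le> r} = space \<nu>" using F(1) by (auto intro: order_trans less_imp_le)
        moreover have "cdf ?\<upsilon> 1 \<le> cdf ?\<upsilon> r" using 3 by (intro V.cdf_nondecreasing) simp
        ultimately show ?thesis using V.cdf_bounded_prob[of r] N.prob_space by (simp add: * G(4))
      qed
    qed
  qed
  then have "distr ?\<mu> borel F = gibbs ?\<upsilon> S"
    by (subst distr_gibbs) auto
  also have "\<dots> = unit_uniform"
    using U.gibbs_gibbs_uminus[OF _ neg(2)] by simp
  finally have push: "distr ?\<mu> borel F = unit_uniform" .
  have "cdf ?\<mu> y = F y" for y
  proof -
    have "AE z in ?\<mu>. cdf \<nu> z \<le> cdf \<nu> y \<longleftrightarrow> z \<le> y"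
      using N.gibbs_equivalent[OF h] N.AE_cdf_le_iff[OF contN, of y]
      by (auto simp: equivalent_probs_def intro: absolutely_continuous_AE[rotated 2])
    then have "AE z in ?\<mu>. z \<in> {..y} \<longleftrightarrow> z \<in> {z. F z \<le> F y}"
      by eventually_elim (simp add: F_le_iff[OF F(1)] F(2))
    then have "measure ?\<mu> {..y} = measure ?\<mu> {z. F z \<le> F y}"
      by (intro M.finite_measure_eq_AE) auto
    also have "\<dots> = cdf (distr ?\<mu> borel F) (F y)"
      by (simp add: cdf_def2 measure_distr vimage_def)
    also have "\<dots> = F y" using F(1)[of y] by (simp add: push cdf_unit_uniform)
    finally show ?thesis by (simp add: cdf_def2)
  qed
  then have "?\<mu> = gibbs \<nu> (\<lambda>y. S (cdf ?\<mu> y))" by simp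
  then show ?thesis using that M.real_distribution_axioms by blast
qed

section \<open>Rewards and quantiles\<close>

lemma bounded_image_divide:
  fixes A :: "real set"
  shows "bounded A \<Longrightarrow> bounded ((\<lambda>x. x / a) ` A)"
  by (rule bounded_linear_image[OF _ bounded_linear_divide])

text \<open>A reward is controlled on the unit interval only. Clamping its argument to that interval gives a
function that is monotone, hence measurable, on the whole line, to which the results on Gibbs
measures apply; the factor \<open>K\<close> is split off because potentials are measured in units of \<open>K\<close>.\<close>

lemma rank_reward_extension:
  assumes "R \<in> rank_rewards" and "0 < K"
  obtains S :: "real \<Rightarrow> real" where "S \<in> borel_measurable borel" "bounded (range S)"
    "\<forall>r\<in>{0..1}. R r = K * S r"
proof
  let ?p = "\<lambda>r::real. max 0 (min 1 r)"
  let ?S = "\<lambda>r. R (?p r) / K"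
  have p: "?p r \<in> {0..1}" for r by auto
  have "mono (\<lambda>r. R (?p r))"
    using assms(1) p by (intro monoI) (auto simp: rank_rewards_def elim!: mono_onD)
  then have "(\<lambda>r. R (?p r)) \<in> borel_measurable borel" by (rule borel_measurable_mono)
  then show "?S \<in> borel_measurable borel" by simp
  have "bounded ((\<lambda>x. x / K) ` (R ` {0..1}))"
    using assms(1) by (intro bounded_image_divide) (auto simp: rank_rewards_def)
  then show "bounded (range ?S)"
    by (rule bounded_subset) (use p in auto)
  show "\<forall>r\<in>{0..1}. R r = K * ?S r" using \<open>0 < K\<close> by (auto simp: max_def min_def)
qed

lemma (in real_distribution) quantile_cdf:
  assumes "strict_mono (cdf M)"
  shows "quantile M (cdf M y) = ereal y"
proof -
  have "{ereal z |z. cdf M y \<le> cdf M z} = ereal ` {y..}"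
    using strict_mono_less_eq[OF assms] by auto
  moreover have "Inf (ereal ` {y..}) = ereal y"
    by (intro Inf_eqI) auto
  ultimately show ?thesis by (simp add: quantile_def)
qed

lemma mono_quantile: "mono (quantile \<mu>)"
  unfolding quantile_def by (intro monoI Inf_superset_mono) auto

lemma mono_at_ereal:
  assumes "mono g" "bounded (range g)"
  shows "mono (at_ereal g)"
proof (rule monoI)
  have bdd: "bdd_above (range g)" "bdd_below (range g)"
    using assms(2) by (auto intro: bounded_imp_bdd_above bounded_imp_bdd_below)
  fix x y :: ereal assume "x \<le> y"
  then show "at_ereal g x \<le> at_ereal g y"
    using assms(1) bdd cINF_lower[OF bdd(2)] cSUP_upper[OF _ bdd(1)]
    by (cases x; cases y)
       (auto simp: at_ereal_def mono_def intro: order_trans[OF cINF_lower[OF bdd(2)] cSUP_upper[OF _ bdd(1)]])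
qed

lemma at_ereal_bounds:
  assumes "bounded (range g)" "\<And>y. \<bar>g y\<bar> \<le> b"
  shows "\<bar>at_ereal g x\<bar> \<le> b"
proof -
  have bdd: "bdd_above (range g)" "bdd_below (range g)"
    using assms(1) by (auto intro: bounded_imp_bdd_above bounded_imp_bdd_below)
  have "g y \<le> b" "- b \<le> g y" for y using assms(2)[of y] by auto
  then have "(SUP y. g y) \<le> b" "- b \<le> (INF y. g y)"
    by (auto intro: cSUP_least cINF_greatest)
  moreover have "g 0 \<le> (SUP y. g y)" "(INF y. g y) \<le> g 0"
    using cINF_lower[OF bdd(2)] cSUP_upper[OF _ bdd(1)] by auto
  ultimately show ?thesis
    using assms(2) assms(2)[of 0] by (cases x) (auto simp: at_ereal_def)
qed

section \<open>Equilibria of the game\<close>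

text \<open>The game depends on the reference measure only through the law of the terminal value, and that
law only has to be equivalent to Lebesgue measure.\<close>

locale rank_game =
  fixes P :: "(real \<Rightarrow> real) measure" and T c \<sigma> :: real and \<nu> :: "real measure"
  assumes c_pos: "0 < c" and \<sigma>_pos: "0 < \<sigma>"
    and prob_space_P: "prob_space P"
    and measurable_terminal [measurable]: "(\<lambda>w. w T) \<in> borel_measurable P"
    and terminal_law: "distr P borel (\<lambda>w. w T) = \<nu>"
    and ac_\<nu>: "absolutely_continuous lborel \<nu>" "absolutely_continuous \<nu> lborel"
begin

abbreviation K :: real where "K \<equiv> 2 * c * \<sigma>\<^sup>2"

lemma K_pos: "0 < K" using c_pos \<sigma>_pos by simp

sublocale P: prob_space P by (rule prob_space_P)

sublocale \<nu>: real_distribution \<nu>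
proof -
  have "prob_space \<nu>" unfolding terminal_law[symmetric] by (rule P.prob_space_distr) measurable
  then show "real_distribution \<nu>"
    unfolding terminal_law[symmetric] by (simp add: real_distribution_def real_distribution_axioms_def)
qed

text \<open>Below, \<open>S\<close> is a globally measurable and bounded version of \<open>R / K\<close>.\<close>

context
  fixes R S :: "real \<Rightarrow> real" and \<mu> :: "real measure"
  assumes S [measurable]: "S \<in> borel_measurable borel" and S_bdd: "bounded (range S)"
    and R_eq: "\<forall>r\<in>{0..1}. R r = K * S r"
    and \<mu>: "real_distribution \<mu>"
begin

interpretation \<mu>: real_distribution \<mu> by (rule \<mu>)

private abbreviation (input) "h \<equiv> \<lambda>y. S (cdf \<mu> y)"

private lemma h_meas: "h \<in> borel_measurable borel" "h \<in> borel_measurable \<nu>" "bounded (range h)"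
  "(\<lambda>w. h (w T)) \<in> borel_measurable P" "bounded (range (\<lambda>w. h (w T)))"
  using S_bdd by (auto intro: bounded_subset)

private lemma payoff_eq:
  assumes "Q \<in> equivalent_probs P"
  shows "payoff P T c \<sigma> R \<mu> Q = ereal K * (ereal (\<integral>w. h (w T) \<partial>Q) - rel_entropy Q P)"
proof -
  have "payoff P T c \<sigma> R \<mu> Q = ereal (K * (\<integral>w. h (w T) \<partial>Q)) - ereal K * rel_entropy Q P"
    using \<mu>.cdf_in_unit by (auto simp: payoff_def bspec[OF R_eq])
  also have "\<dots> = ereal K * (ereal (\<integral>w. h (w T) \<partial>Q) - rel_entropy Q P)"
    using K_pos by (simp add: rel_entropy_def algebra_simps)
  finally show ?thesis .
qed

lemma integral_exp_terminal: "(\<integral>w. exp (h (w T)) \<partial>P) = (\<integral>y. exp (h y) \<partial>\<nu>)"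
  unfolding terminal_law[symmetric] by (subst integral_distr) auto

lemma payoff_le:
  assumes "Q \<in> equivalent_probs P"
  shows "payoff P T c \<sigma> R \<mu> Q \<le> ereal (K * ln (\<integral>y. exp (h y) \<partial>\<nu>))"
    and "payoff P T c \<sigma> R \<mu> Q = ereal (K * ln (\<integral>y. exp (h y) \<partial>\<nu>)) \<longleftrightarrow> Q = gibbs P (\<lambda>w. h (w T))"
proof -
  note V = P.gibbs_variational[OF h_meas(4,5) assms, unfolded integral_exp_terminal]
  have "ereal K * (ereal (\<integral>w. h (w T) \<partial>Q) - rel_entropy Q P) \<le> ereal K * ereal (ln (\<integral>y. exp (h y) \<partial>\<nu>))"
    using V(1) K_pos by (intro ereal_mult_left_mono) auto
  then show "payoff P T c \<sigma> R \<mu> Q \<le> ereal (K * ln (\<integral>y. exp (h y) \<partial>\<nu>))"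
    by (simp add: payoff_eq[OF assms])
  show "payoff P T c \<sigma> R \<mu> Q = ereal (K * ln (\<integral>y. exp (h y) \<partial>\<nu>)) \<longleftrightarrow> Q = gibbs P (\<lambda>w. h (w T))"
    unfolding payoff_eq[OF assms] V(2)[symmetric]
    using K_pos by (cases "rel_entropy Q P") auto
qed

lemma player_value_eq: "player_value P T c \<sigma> R \<mu> = ereal (K * ln (\<integral>y. exp (h y) \<partial>\<nu>))"
  unfolding player_value_def
proof (rule antisym)
  show "(SUP Q\<in>equivalent_probs P. payoff P T c \<sigma> R \<mu> Q) \<le> ereal (K * ln (\<integral>y. exp (h y) \<partial>\<nu>))"
    by (intro SUP_least payoff_le(1))
  have "gibbs P (\<lambda>w. h (w T)) \<in> equivalent_probs P"
    using h_meas by (intro P.gibbs_equivalent)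
  then show "ereal (K * ln (\<integral>y. exp (h y) \<partial>\<nu>)) \<le> (SUP Q\<in>equivalent_probs P. payoff P T c \<sigma> R \<mu> Q)"
    using payoff_le(2) by (metis SUP_upper)
qed

text \<open>The best response to \<open>\<mu>\<close> is the Gibbs measure on path space, and its terminal law is the Gibbs measure
over \<open>\<nu>\<close>; so the equilibrium condition no longer involves paths.\<close>

lemma is_equilibrium_iff: "is_equilibrium P T c \<sigma> R \<mu> \<longleftrightarrow> \<mu> = gibbs \<nu> h"
proof -
  have "gibbs P (\<lambda>w. h (w T)) \<in> equivalent_probs P"
    using h_meas by (intro P.gibbs_equivalent)
  moreover have "distr (gibbs P (\<lambda>w. h (w T))) borel (\<lambda>w. w T) = gibbs \<nu> h"
    using distr_gibbs[OF measurable_terminal h_meas(1)] by (simp add: terminal_law)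
  ultimately show ?thesis
    using payoff_le(2) \<mu>.prob_space_axioms
    by (auto simp: is_equilibrium_def player_value_eq)
qed

lemma LBINT_reward: 
  assumes "\<mu> = gibbs \<nu> h"
  shows "(LBINT r:{0..1}. R r) = K * (\<integral>y. h y \<partial>\<mu>)"
proof -
  have "absolutely_continuous lborel \<mu>"
    using \<nu>.gibbs_equivalent[OF h_meas(2,3)] ac_\<nu>(1) assms
    by (auto simp: equivalent_probs_def intro: absolutely_continuous_trans)
  then have push: "distr \<mu> borel (cdf \<mu>) = unit_uniform"
    by (intro \<mu>.distr_cdf_eq_unit_uniform \<mu>.isCont_cdf_of_ac)
  have "(LBINT r:{0..1}. R r) = (LBINT r:{0..1}. K * S r)"
    by (intro set_lebesgue_integral_cong) (auto simp: R_eq)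
  also have "\<dots> = (\<integral>r. K * S r \<partial>unit_uniform)"
    by (rule integral_unit_uniform[symmetric]) simp
  also have "\<dots> = K * (\<integral>y. h y \<partial>\<mu>)"
    unfolding push[symmetric] by (simp add: integral_distr)
  finally show ?thesis .
qed

end

lemma equilibrium_eqI:
  assumes "R \<in> rank_rewards" "is_equilibrium P T c \<sigma> R \<mu>"
  shows "equilibrium P T c \<sigma> R = \<mu>"
  unfolding equilibrium_def
proof (rule the_equality)
  show "is_equilibrium P T c \<sigma> R \<mu>" by (rule assms(2))
next
  fix \<mu>' assume eq': "is_equilibrium P T c \<sigma> R \<mu>'"
  obtain S where S: "S \<in> borel_measurable borel" "bounded (range S)" "\<forall>r\<in>{0..1}. R r = K * S r"
    using rank_reward_extension[OF assms(1) K_pos] by blast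
  have distr: "real_distribution \<mu>" "real_distribution \<mu>'"
    using assms(2) eq' by (auto simp: is_equilibrium_def real_distribution_def real_distribution_axioms_def)
  have fixed: "\<mu> = gibbs \<nu> (\<lambda>y. S (cdf \<mu> y))"
    by (rule is_equilibrium_iff[OF S distr(1), THEN iffD1, OF assms(2)])
  have fixed': "\<mu>' = gibbs \<nu> (\<lambda>y. S (cdf \<mu>' y))"
    by (rule is_equilibrium_iff[OF S distr(2), THEN iffD1, OF eq'])
  show "\<mu>' = \<mu>"
    by (rule gibbs_fixed_point_unique[OF \<nu>.real_distribution_axioms ac_\<nu>(1) S(1,2) distr(2) fixed' distr(1) fixed])
qed

lemma equilibrium_exists:
  assumes "R \<in> rank_rewards"
  obtains \<mu> where "is_equilibrium P T c \<sigma> R \<mu>" "real_distribution \<mu>"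
proof -
  obtain S where S: "S \<in> borel_measurable borel" "bounded (range S)" "\<forall>r\<in>{0..1}. R r = K * S r"
    using rank_reward_extension[OF assms K_pos] by blast
  obtain \<mu> where "real_distribution \<mu>" "\<mu> = gibbs \<nu> (\<lambda>y. S (cdf \<mu> y))"
    using gibbs_fixed_point_exists[OF \<nu>.real_distribution_axioms ac_\<nu>(1) S(1,2)] by blast
  then show ?thesis using is_equilibrium_iff[OF S] that by blast
qed

section \<open>The principal's problem\<close>

context
  fixes g :: "real \<Rightarrow> real" and V0 :: real
  assumes g_mono: "mono g" and g_bdd: "bounded (range g)"
begin

abbreviation Z :: real where "Z \<equiv> (\<integral>y. exp (g y / K) \<partial>\<nu>)"

abbreviation target :: "real measure" where "target \<equiv> gibbs \<nu> (\<lambda>y. g y / K)"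

abbreviation optimal_reward :: "real \<Rightarrow> real" where
  "optimal_reward \<equiv> \<lambda>r. V0 + at_ereal g (quantile target r) - K * ln Z"

private lemma g_meas: "g \<in> borel_measurable borel" using g_mono by (rule borel_measurable_mono)

private lemma gK: "(\<lambda>y. g y / K) \<in> borel_measurable \<nu>" "bounded (range (\<lambda>y. g y / K))"
proof -
  have "bounded ((\<lambda>x. x / K) ` range g)"
    using g_bdd by (rule bounded_image_divide)
  then show "bounded (range (\<lambda>y. g y / K))" by (simp add: image_image)
qed (use g_meas in simp)

lemma real_distribution_target: "real_distribution target"
  using gK by (intro real_distribution_gibbs \<nu>.real_distribution_axioms) auto

text \<open>The law \<open>target\<close> charges every interval, so its quantile function inverts its distribution function,
and the optimal reward pays an output \<open>y\<close> exactly what it is worth, up to an additive constant.\<close>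

lemma optimal_reward_cdf: "optimal_reward (cdf target y) = V0 + g y - K * ln Z"
proof -
  interpret real_distribution target by (rule real_distribution_target)
  have "absolutely_continuous target lborel"
    using \<nu>.gibbs_equivalent[OF gK] ac_\<nu>(2)
    by (auto simp: equivalent_probs_def intro: absolutely_continuous_trans)
  then have "quantile target (cdf target y) = ereal y"
    by (intro quantile_cdf strict_mono_cdf_of_ac)
  then show ?thesis by (simp add: at_ereal_def)
qed

lemma optimal_reward_rank: "optimal_reward \<in> rank_rewards"
proof -
  have "mono (\<lambda>r. at_ereal g (quantile target r))"
    using mono_at_ereal[OF g_mono g_bdd] mono_quantile by (auto simp: mono_def)
  then have "mono_on {0..1} optimal_reward" by (auto simp: mono_def mono_on_def)
  moreover obtain b where b: "\<And>y. \<bar>g y\<bar> \<le> b" using g_bdd by (auto simp: bounded_iff)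
  have "norm (optimal_reward r) \<le> \<bar>V0\<bar> + b + \<bar>K * ln Z\<bar>" for r
    using at_ereal_bounds[OF g_bdd b, of "quantile target r"] unfolding real_norm_def by linarith
  then have "bounded (range optimal_reward)" unfolding bounded_iff by blast
  then have "bounded (optimal_reward ` {0..1})" by (rule bounded_subset) auto
  ultimately show ?thesis by (simp add: rank_rewards_def)
qed

text \<open>With \<open>h = S \<circ> F\<^sub>\<mu>\<close> and \<open>C = \<integral> exp h d\<nu>\<close>, the net profit is \<open>K (E\<^sup>\<mu>[g / K] - E\<^sup>\<mu>[h])\<close> and
\<open>H(\<mu>|\<nu>) = E\<^sup>\<mu>[h] - ln C\<close>. The variational principle for the potential \<open>g / K\<close> then gives the bound
\<open>K ln Z - K ln C\<close>, and \<open>K ln C\<close> is the game value. In the case of equality \<open>\<mu> = target\<close>, so \<open>h\<close> and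
\<open>g / K\<close> differ by a constant, which the binding constraint \<open>K ln C = V0\<close> determines.\<close>

lemma net_profit_bound:
  assumes R: "R \<in> feasible_rewards P T c \<sigma> V0"
  shows "net_profit P T c \<sigma> g R \<le> K * ln Z - V0"
    and "net_profit P T c \<sigma> g R = K * ln Z - V0 \<Longrightarrow> AE r in lborel. r \<in> {0..1} \<longrightarrow> R r = optimal_reward r"
proof -
  have rank: "R \<in> rank_rewards" using R by (simp add: feasible_rewards_def)
  obtain S where S: "S \<in> borel_measurable borel" "bounded (range S)" "\<forall>r\<in>{0..1}. R r = K * S r"
    using rank_reward_extension[OF rank K_pos] by blast
  obtain \<mu> where \<mu>: "is_equilibrium P T c \<sigma> R \<mu>" "real_distribution \<mu>"
    using equilibrium_exists[OF rank] by blast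
  interpret \<mu>: real_distribution \<mu> by fact
  let ?h = "\<lambda>y. S (cdf \<mu> y)"
  let ?C = "\<integral>y. exp (?h y) \<partial>\<nu>"
  have \<mu>_eq: "\<mu> = gibbs \<nu> ?h" using \<mu> is_equilibrium_iff[OF S] by blast
  have eq: "equilibrium P T c \<sigma> R = \<mu>" using rank \<mu>(1) by (rule equilibrium_eqI)
  have h: "?h \<in> borel_measurable \<nu>" "bounded (range ?h)"
    using S by (auto intro: bounded_subset)
  have gval: "game_value P T c \<sigma> R = ereal (K * ln ?C)"
    unfolding game_value_def eq by (rule player_value_eq[OF S \<mu>(2)])
  have "ereal V0 \<le> game_value P T c \<sigma> R" using R by (simp add: feasible_rewards_def)
  then have V0: "V0 \<le> K * ln ?C"
    by (simp only: gval ereal_less_eq)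
  have Q: "gibbs \<nu> ?h \<in> equivalent_probs \<nu>" using h by (rule \<nu>.gibbs_equivalent)
  have ent: "rel_entropy \<mu> \<nu> = ereal ((\<integral>y. ?h y \<partial>\<mu>) - ln ?C)"
    using \<nu>.rel_entropy_gibbs[OF h] \<mu>_eq by simp
  have profit: "net_profit P T c \<sigma> g R = K * ((\<integral>y. g y / K \<partial>\<mu>) - (\<integral>y. ?h y \<partial>\<mu>))"
  proof -
    have "(LBINT r:{0..1}. R r) = K * (\<integral>y. ?h y \<partial>\<mu>)"
      by (rule LBINT_reward[OF S \<mu>(2) \<mu>_eq])
    then show ?thesis
      using c_pos \<sigma>_pos by (simp add: net_profit_def eq right_diff_distrib)
  qed
  have gap: "(\<integral>y. g y / K \<partial>\<mu>) - (\<integral>y. ?h y \<partial>\<mu>) \<le> ln Z - ln ?C"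
    using \<nu>.gibbs_variational(1)[OF gK Q[folded \<mu>_eq]] by (simp add: ent)
  have gap_eq: "(\<integral>y. g y / K \<partial>\<mu>) - (\<integral>y. ?h y \<partial>\<mu>) = ln Z - ln ?C \<Longrightarrow> \<mu> = target"
    using \<nu>.gibbs_variational(2)[OF gK Q[folded \<mu>_eq]] by (simp add: ent)
  have "net_profit P T c \<sigma> g R \<le> K * (ln Z - ln ?C)"
    unfolding profit using gap K_pos by (intro mult_left_mono) auto
  then have profit_le: "net_profit P T c \<sigma> g R \<le> K * ln Z - K * ln ?C"
    by (simp add: right_diff_distrib)
  then show "net_profit P T c \<sigma> g R \<le> K * ln Z - V0" using V0 by linarith
  assume opt: "net_profit P T c \<sigma> g R = K * ln Z - V0"
  then have C: "K * ln ?C = V0" using profit_le V0 by linarith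
  have "K * ((\<integral>y. g y / K \<partial>\<mu>) - (\<integral>y. ?h y \<partial>\<mu>)) = K * (ln Z - ln ?C)"
    using opt C profit by (simp only: right_diff_distrib)
  then have \<mu>_target: "\<mu> = target" using c_pos \<sigma>_pos by (intro gap_eq) (simp only: mult_cancel_left, simp)
  have "AE y in \<nu>. ?h y - ln ?C = g y / K - ln Z"
    using \<mu>_eq \<mu>_target by (intro \<nu>.gibbs_eq_imp_AE h gK) auto
  then have "AE y in \<nu>. K * ?h y = V0 + g y - K * ln Z"
  proof eventually_elim
    case (elim y)
    have "K * ?h y - K * ln ?C = K * (g y / K) - K * ln Z"
      using arg_cong[OF elim, of "\<lambda>x. K * x"] by (simp only: right_diff_distrib)
    moreover have "K * (g y / K) = g y" using c_pos \<sigma>_pos by simp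
    ultimately show ?case using C by linarith
  qed
  then have "AE y in \<nu>. R (cdf \<mu> y) = optimal_reward (cdf \<mu> y)"
  proof eventually_elim
    case (elim y)
    have "optimal_reward (cdf \<mu> y) = V0 + g y - K * ln Z"
      unfolding \<mu>_target by (rule optimal_reward_cdf)
    then show ?case using elim bspec[OF S(3) \<mu>.cdf_in_unit, of y] by (simp only:)
  qed
  moreover have ac: "absolutely_continuous \<nu> \<mu>"
    using Q unfolding \<mu>_eq[symmetric] by (simp add: equivalent_probs_def)
  moreover have sets_eq: "sets \<mu> = sets \<nu>" by (subst \<mu>_eq) simp
  ultimately have AE_\<mu>: "AE y in \<mu>. R (cdf \<mu> y) = optimal_reward (cdf \<mu> y)"
    by (intro absolutely_continuous_AE[OF sets_eq ac])
  have cont: "isCont (cdf \<mu>) y" for y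
    using absolutely_continuous_trans[OF ac_\<nu>(1) ac] by (rule \<mu>.isCont_cdf_of_ac)
  \<comment> \<open>The set where the two rewards agree must be measurable to be pulled back along \<open>cdf \<mu>\<close>, so the globally measurable versions are compared instead.\<close>
  obtain S' where S': "S' \<in> borel_measurable borel" "\<forall>r\<in>{0..1}. optimal_reward r = K * S' r"
    using rank_reward_extension[OF optimal_reward_rank K_pos] by blast
  have "AE y in \<mu>. S (cdf \<mu> y) = S' (cdf \<mu> y)"
    using AE_\<mu>
  proof eventually_elim
    case (elim y)
    have "K * S (cdf \<mu> y) = K * S' (cdf \<mu> y)"
      using bspec[OF S(3) \<mu>.cdf_in_unit, of y] bspec[OF S'(2) \<mu>.cdf_in_unit, of y] elim by (simp only:)
    then show ?case using K_pos by (metis less_irrefl mult_left_cancel)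
  qed
  then have "AE r in distr \<mu> borel (cdf \<mu>). S r = S' r"
  proof (subst AE_distr_iff)
    show "{r \<in> space borel. S r = S' r} \<in> sets borel" using S(1) S'(1) by measurable
  qed simp_all
  then have "AE r in unit_uniform. S r = S' r"
    by (simp only: \<mu>.distr_cdf_eq_unit_uniform[OF cont])
  then have "AE r in lborel. r \<in> {0..1} \<longrightarrow> S r = S' r"
    using AE_uniform_measure[of lborel "{0..1}" "\<lambda>r. S r = S' r"] by simp
  then show "AE r in lborel. r \<in> {0..1} \<longrightarrow> R r = optimal_reward r"
  proof eventually_elim
    case (elim r)
    show ?case
    proof
      assume r: "r \<in> {0..1}"
      have "R r = K * S r" by (rule bspec[OF S(3) r])
      also have "S r = S' r" using elim r by (rule mp)
      also have "K * S' r = optimal_reward r" by (rule bspec[OF S'(2) r, symmetric])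
      finally show "R r = optimal_reward r" .
    qed
  qed
qed

text \<open>Evaluated at the ranks of \<open>target\<close>, the optimal reward is \<open>g\<close> plus a constant, and constants do not
change Gibbs measures; hence \<open>target\<close> is a fixed point for this reward. The constant is
the one for which the game value is \<open>V0\<close>.\<close>

lemma optimal_reward_attains:
  shows "equilibrium P T c \<sigma> optimal_reward = target"
    and "optimal_reward \<in> feasible_rewards P T c \<sigma> V0"
    and "net_profit P T c \<sigma> g optimal_reward = K * ln Z - V0"
proof -
  obtain S where S: "S \<in> borel_measurable borel" "bounded (range S)"
    "\<forall>r\<in>{0..1}. optimal_reward r = K * S r"
    using rank_reward_extension[OF optimal_reward_rank K_pos] by blast
  interpret target: real_distribution target by (rule real_distribution_target)
  let ?a = "V0 / K - ln Z"
  have h: "S (cdf target y) = g y / K + ?a" for y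
  proof -
    have "K * S (cdf target y) = V0 + g y - K * ln Z"
      using bspec[OF S(3) target.cdf_in_unit] optimal_reward_cdf[of y] by simp
    moreover have "s = x / k + (v / k - z)" if "0 < k" "k * s = v + x - k * z" for k s v x z :: real
      using that by (simp add: field_simps)
    ultimately show ?thesis using K_pos by blast
  qed
  note const = \<nu>.gibbs_add_const[OF gK, of ?a]
  have fixed_pt: "target = gibbs \<nu> (\<lambda>y. S (cdf target y))" by (simp only: h const)
  then have "is_equilibrium P T c \<sigma> optimal_reward target"
    using is_equilibrium_iff[OF S real_distribution_target] by blast
  then show eq: "equilibrium P T c \<sigma> optimal_reward = target"
    by (rule equilibrium_eqI[OF optimal_reward_rank])
  have "game_value P T c \<sigma> optimal_reward = ereal (K * ln (\<integral>y. exp (S (cdf target y)) \<partial>\<nu>))"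
    unfolding game_value_def eq by (rule player_value_eq[OF S real_distribution_target])
  also have "\<dots> = ereal (K * (ln Z + ?a))" unfolding h const ..
  also have "K * (ln Z + ?a) = V0" using c_pos \<sigma>_pos by simp
  finally show "optimal_reward \<in> feasible_rewards P T c \<sigma> V0"
    using optimal_reward_rank by (simp add: feasible_rewards_def)
  have gi: "integrable target g"
    using g_meas g_bdd by (intro target.integrable_bounded) auto
  have "(LBINT r:{0..1}. optimal_reward r) = K * (\<integral>y. S (cdf target y) \<partial>target)"
    by (rule LBINT_reward[OF S real_distribution_target fixed_pt])
  also have "\<dots> = K * (\<integral>y. g y / K + ?a \<partial>target)" unfolding h ..
  also have "\<dots> = (\<integral>y. K * (g y / K + ?a) \<partial>target)" by simp
  also have "\<dots> = (\<integral>y. g y + (V0 - K * ln Z) \<partial>target)"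
    using c_pos \<sigma>_pos by (intro Bochner_Integration.integral_cong) (auto simp: field_simps)
  also have "\<dots> = (\<integral>y. g y \<partial>target) + (V0 - K * ln Z)"
    using gi target.prob_space by simp
  finally show "net_profit P T c \<sigma> g optimal_reward = K * ln Z - V0"
    by (simp only: net_profit_def eq)
qed

end

end

section \<open>The terminal law of the path measure\<close>

lemma path_law_terminal:
  assumes B: "standard_brownian_motion M T B" and "T > 0" "\<sigma> > 0"
  shows "prob_space (path_law M T B x0 \<sigma>)"
    and "(\<lambda>w. w T) \<in> borel_measurable (path_law M T B x0 \<sigma>)"
    and "distr (path_law M T B x0 \<sigma>) borel (\<lambda>w. w T) = density lborel (normal_density x0 (\<sigma> * sqrt T))"
proof -
  interpret prob_space M using B by (simp add: standard_brownian_motion_def)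
  let ?X = "\<lambda>\<omega>. \<lambda>t\<in>{0..T}. x0 + \<sigma> * B t \<omega>"
  have [measurable]: "B t \<in> borel_measurable M" if "t \<in> {0..T}" for t
    using B that by (auto simp: standard_brownian_motion_def)
  have X: "?X \<in> measurable M (path_space T)"
    unfolding path_space_def
  proof (rule measurable_restrict_space2)
    have "continuous_on {0..T} (?X \<omega>)" if "\<omega> \<in> space M" for \<omega>
    proof -
      have "continuous_on {0..T} (\<lambda>t. x0 + \<sigma> * B t \<omega>)"
        using B that by (intro continuous_intros) (auto simp: standard_brownian_motion_def)
      then show ?thesis by (rule continuous_on_eq) auto
    qed
    then show "?X \<in> space M \<rightarrow> {w. continuous_on {0..T} w}" by auto
    show "?X \<in> measurable M (Pi\<^sub>M {0..T} (\<lambda>_. borel))"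
      by (rule measurable_restrict) measurable
  qed
  then show "prob_space (path_law M T B x0 \<sigma>)"
    unfolding path_law_def by (rule prob_space_distr)
  have ev: "(\<lambda>w. w T) \<in> borel_measurable (path_space T)"
    unfolding path_space_def using \<open>T > 0\<close>
    by (intro measurable_restrict_space1 measurable_component_singleton) auto
  then show "(\<lambda>w. w T) \<in> borel_measurable (path_law M T B x0 \<sigma>)"
    by (simp add: path_law_def)
  have "distributed M lborel (\<lambda>\<omega>. B T \<omega> - B 0 \<omega>) (normal_density 0 (sqrt (T - 0)))"
    using B \<open>T > 0\<close> by (simp only: standard_brownian_motion_def) blast
  then have "distributed M lborel (\<lambda>\<omega>. x0 + \<sigma> * (B T \<omega> - B 0 \<omega>)) (normal_density (x0 + \<sigma> * 0) (\<bar>\<sigma>\<bar> * sqrt (T - 0)))"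
    using assms(2,3) by (intro normal_density_affine) auto
  then have "distr M lborel (\<lambda>\<omega>. x0 + \<sigma> * (B T \<omega> - B 0 \<omega>)) = density lborel (normal_density x0 (\<sigma> * sqrt T))"
    using \<open>\<sigma> > 0\<close> by (simp add: distributed_distr_eq_density)
  moreover have "distr (path_law M T B x0 \<sigma>) borel (\<lambda>w. w T) = distr M borel (\<lambda>\<omega>. x0 + \<sigma> * B T \<omega>)"
    unfolding path_law_def using X ev \<open>T > 0\<close> by (subst distr_distr) (auto simp: comp_def)
  moreover have "\<dots> = distr M lborel (\<lambda>\<omega>. x0 + \<sigma> * (B T \<omega> - B 0 \<omega>))"
    using B by (intro distr_cong) (auto simp: standard_brownian_motion_def)
  ultimately show "distr (path_law M T B x0 \<sigma>) borel (\<lambda>w. w T) = density lborel (normal_density x0 (\<sigma> * sqrt T))"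
    by simp
qed

lemma absolutely_continuous_normal:
  assumes "0 < s"
  shows "absolutely_continuous lborel (density lborel (normal_density m s))"
    and "absolutely_continuous (density lborel (normal_density m s)) lborel"
proof -
  show "absolutely_continuous lborel (density lborel (normal_density m s))"
    by (intro absolutely_continuousI_density) auto
  show "absolutely_continuous (density lborel (normal_density m s)) lborel"
    unfolding absolutely_continuous_def
  proof
    fix A assume "A \<in> null_sets (density lborel (normal_density m s))"
    then have "A \<in> sets borel" and "AE x in lborel. x \<in> A \<longrightarrow> normal_density m s x \<le> 0"
      by (auto simp: null_sets_density_iff ennreal_eq_0_iff)
    moreover have "\<not> normal_density m s x \<le> 0" for x
      using normal_density_pos[OF assms, of m x] by simp
    ultimately show "A \<in> null_sets lborel" by (simp add: AE_iff_null_sets)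
  qed
qed

theorem theorem5p3:
  fixes T \<sigma> c x0 V0 :: real
    and g :: "real \<Rightarrow> real"
    and M :: "'a measure" and B :: "real \<Rightarrow> 'a \<Rightarrow> real"
  assumes "T > 0" and "\<sigma> > 0" and "c > 0"
    and "standard_brownian_motion M T B"
    and "mono g" and "bounded (range g)"
  defines "P \<equiv> path_law M T B x0 \<sigma>"
    and "f0 \<equiv> normal_density x0 (\<sigma> * sqrt T)"
  defines "Z \<equiv> (\<integral>y. exp (g y / (2 * c * \<sigma>\<^sup>2)) * f0 y \<partial>lborel)"
  defines "\<mu>s \<equiv> density lborel (\<lambda>y. ennreal (exp (g y / (2 * c * \<sigma>\<^sup>2)) * f0 y / Z))"
  defines "Rs \<equiv> (\<lambda>r. V0 + at_ereal g (quantile \<mu>s r) - 2 * c * \<sigma>\<^sup>2 * ln Z)"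
  shows "is_arg_max (net_profit P T c \<sigma> g) (\<lambda>R. R \<in> feasible_rewards P T c \<sigma> V0) Rs \<and>
    (\<forall>R. is_arg_max (net_profit P T c \<sigma> g) (\<lambda>R. R \<in> feasible_rewards P T c \<sigma> V0) R \<longrightarrow>
         (AE r in lborel. r \<in> {0..1} \<longrightarrow> R r = Rs r)) \<and>
    (\<integral>y. g y \<partial>equilibrium P T c \<sigma> Rs) =
      (\<integral>y. exp (g y / (2 * c * \<sigma>\<^sup>2)) * f0 y * g y \<partial>lborel) / Z \<and>
    net_profit P T c \<sigma> g Rs = 2 * c * \<sigma>\<^sup>2 * ln Z - V0"
proof -
  let ?\<nu> = "density lborel f0"
  let ?K = "2 * c * \<sigma>\<^sup>2"
  have s: "0 < \<sigma> * sqrt T" using \<open>T > 0\<close> \<open>\<sigma> > 0\<close> by simp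
  interpret rank_game P T c \<sigma> ?\<nu>
    unfolding P_def f0_def
    by (rule rank_game.intro path_law_terminal absolutely_continuous_normal assms(1-4) s)+
  have [measurable]: "f0 \<in> borel_measurable borel" "g \<in> borel_measurable borel"
    using \<open>mono g\<close> by (auto simp: f0_def intro: borel_measurable_mono)
  have f0: "0 \<le> f0 y" for y by (simp add: f0_def)
  have Z: "(\<integral>y. exp (g y / ?K) \<partial>?\<nu>) = Z"
    unfolding Z_def using f0 by (subst integral_density) (auto simp: mult.commute)
  have "Z > 0"
    unfolding Z[symmetric] using \<open>bounded (range g)\<close> bounded_image_divide[of "range g" ?K]
    by (intro \<nu>.integral_exp_pos) (auto simp: image_image)
  then have \<mu>s: "gibbs ?\<nu> (\<lambda>y. g y / ?K) = \<mu>s"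
    unfolding gibbs_def Z \<mu>s_def using f0
    by (subst density_density_eq) (auto intro!: density_cong simp: mult.commute simp flip: ennreal_mult)
  note game = \<open>mono g\<close> \<open>bounded (range g)\<close>
  have attain: "equilibrium P T c \<sigma> Rs = \<mu>s" "Rs \<in> feasible_rewards P T c \<sigma> V0"
    "net_profit P T c \<sigma> g Rs = ?K * ln Z - V0"
    using optimal_reward_attains[OF game, of V0] unfolding Z \<mu>s Rs_def .
  have bound: "net_profit P T c \<sigma> g R \<le> ?K * ln Z - V0"
    "net_profit P T c \<sigma> g R = ?K * ln Z - V0 \<Longrightarrow> AE r in lborel. r \<in> {0..1} \<longrightarrow> R r = Rs r"
    if "R \<in> feasible_rewards P T c \<sigma> V0" for R
    using net_profit_bound[OF game that] unfolding Z \<mu>s Rs_def .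
  have "AE r in lborel. r \<in> {0..1} \<longrightarrow> R r = Rs r"
    if "is_arg_max (net_profit P T c \<sigma> g) (\<lambda>R. R \<in> feasible_rewards P T c \<sigma> V0) R" for R
  proof (rule bound(2))
    show R: "R \<in> feasible_rewards P T c \<sigma> V0" using that by (simp add: is_arg_max_def)
    show "net_profit P T c \<sigma> g R = ?K * ln Z - V0"
      using that attain bound(1)[OF R] by (auto simp: is_arg_max_linorder)
  qed
  moreover have "is_arg_max (net_profit P T c \<sigma> g) (\<lambda>R. R \<in> feasible_rewards P T c \<sigma> V0) Rs"
    using attain bound(1) by (simp add: is_arg_max_linorder)
  moreover have "(\<integral>y. g y \<partial>\<mu>s) = (\<integral>y. exp (g y / ?K) * f0 y * g y \<partial>lborel) / Z"
    unfolding \<mu>s_def using f0 \<open>Z > 0\<close> by (subst integral_density) auto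
  ultimately show ?thesis using attain by simp
qed

end
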